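(* Let $\varphi=\frac{1+\sqrt5}{2}$. For every integer $N\ge 1$, $$\lambda_{N+k}(\varphi)-\lambda_k(\varphi)\ \ge\ N\gamma_{2,N}\qquad\text{for all } k\ge 1,$$ where $$\gamma_{2,N}:=\frac1\varphi+\frac1{\varphi^3}-\frac1N\left(\frac1{\varphi^4}+\varphi\right).$$ Moreover, for $N=2$ the estimate is sharpened: the inequality $\lambda_{2+k}(\varphi)-\lambda_k(\varphi)\ge 2\gamma_{2,2}$ for all $k\ge 1$ also holds with $\gamma_{2,2}=\frac{\varphi}{2}$.
   Context: The spectrum of the golden mean $\varphi$ (the largest root of $x^2-x-1$) is $\Lambda(\varphi):=\left\{\sum_{i=0}^n\varepsilon_i\varphi^i\mid \varepsilon_i\in\{0,1\},\ n=0,1,\dots\right\}$. Its elements are listed in strictly increasing order as $\Lambda(\varphi)=\{0<\lambda_1(\varphi)<\lambda_2(\varphi)<\cdots\}$. *)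

theory Defs
  imports Complex_Main
begin

definition golden_mean :: real ("\<phi>") where
  "\<phi> = (1 + sqrt 5) / 2"

definition spectrum :: "real \<Rightarrow> real set" ("\<Lambda>") where
  "\<Lambda> q = {(\<Sum>i\<le>n. e i * q ^ i) | (e :: nat \<Rightarrow> real) (n :: nat). \<forall>i\<le>n. e i \<in> {0, 1}}"

(* The increasing listing of the spectrum. Since 0 is its least element, index 0 is
   the value 0, and spectrum_nth q k is lambda_k(q) for k >= 1. The description is
   meaningful only if the spectrum has order type omega, which holds for every q > 1
   (it is infinite, consists of nonnegative reals, and meets every bounded set in a
   finite set). *)
definition spectrum_nth :: "real \<Rightarrow> nat \<Rightarrow> real" where
  "spectrum_nth q = (THE l. strict_mono l \<and> range l = \<Lambda> q)"

definition gamma2 :: "nat \<Rightarrow> real" where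
  "gamma2 N = 1 / \<phi> + 1 / \<phi> ^ 3 - 1 / real N * (1 / \<phi> ^ 4 + \<phi>)"

end

theory Submission
  imports Defs
begin

text \<open>
  Write \<open>\<phi>' = -1/\<phi>\<close> for the conjugate of \<open>\<phi>\<close>. A sum \<open>x = \<Sum>\<epsilon>\<^sub>i \<phi>^i\<close> with digits
  in \<open>{0, 1}\<close> has the form \<open>x = a + b \<phi>\<close> with natural numbers \<open>a, b\<close>, and its conjugate
  \<open>y = a + b \<phi>' = \<Sum>\<epsilon>\<^sub>i \<phi>'^i\<close> lies strictly between the sum \<open>-1\<close> of the odd powers of
  \<open>\<phi>'\<close> and the sum \<open>\<phi>\<close> of the even ones. Conversely, every \<open>a + b \<phi>\<close> with \<open>b \<ge> 0\<close> whose conjugate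
  lies in the window \<open>(-1, \<phi>)\<close> belongs to the spectrum, because its digits can be read off one
  at a time (\<open>spectrum_imp_window\<close>, \<open>window_imp_spectrum\<close>): the spectrum is a cut-and-project set.

  The window has length \<open>\<phi>\<^sup>2\<close>, and for \<open>n = a + 2b\<close> the conjugate is \<open>y = n - b \<phi>\<^sup>2\<close>.
  Hence for each \<open>n \<ge> 0\<close> exactly one \<open>b\<close> puts \<open>y\<close> into the window, namely
  \<open>b = \<lfloor>(n + 1) / \<phi>\<^sup>2\<rfloor>\<close>, and the corresponding element is
  \<open>n - (2 - \<phi>) b = n - \<lfloor>(n + 1) / \<phi>\<^sup>2\<rfloor> / \<phi>\<^sup>2\<close>. As this is strictly increasing in
  \<open>n\<close>, it is \<open>\<lambda>\<^sub>n\<close> (\<open>spectrum_nth_eq\<close>).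

  Over \<open>N\<close> consecutive indices the floor grows by less than \<open>N / \<phi>\<^sup>2 + 1\<close>, so
  \<open>\<lambda>\<^bsub>N+k\<^esub> - \<lambda>\<^sub>k\<close> exceeds \<open>N (1 - 1/\<phi>^4) - 1/\<phi>\<^sup>2\<close>. Since
  \<open>1 - 1/\<phi>^4 = 1/\<phi> + 1/\<phi>^3\<close>, this is stronger than the first bound. For \<open>N = 2\<close> the floor
  grows by at most \<open>1\<close>, which gives the gap \<open>2 - 1/\<phi>\<^sup>2 = \<phi>\<close>.
\<close>

section \<open>Arithmetic of the golden mean\<close>

lemma golden_mean_square: "\<phi> * \<phi> = \<phi> + 1"
  by (simp add: golden_mean_def field_simps)

lemma golden_mean_bounds: "3/2 < \<phi>" "\<phi> < 5/3"
proof -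
  have "2 < sqrt 5" by (rule real_less_rsqrt) simp
  then show "3/2 < \<phi>" by (simp add: golden_mean_def)
  have "sqrt 5 < 7/3" by (rule real_less_lsqrt) (simp_all add: power2_eq_square)
  then show "\<phi> < 5/3" by (simp add: golden_mean_def)
qed

lemma golden_mean_inverse: "1 / \<phi> = \<phi> - 1"
  using golden_mean_square golden_mean_bounds by (simp add: field_simps)

lemma golden_mean_inverse_powers:
  "1 / \<phi> ^ 3 = 2 * \<phi> - 3" "1 / \<phi> ^ 4 = 5 - 3 * \<phi>"
proof -
  have inv_pow: "1 / \<phi> ^ n = (\<phi> - 1) ^ n" for n
    by (metis golden_mean_inverse power_one_over)
  have sq: "(\<phi> - 1) * (\<phi> - 1) = 2 - \<phi>"
    using golden_mean_square by (simp add: algebra_simps)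
  have "(\<phi> - 1) ^ 3 = (2 - \<phi>) * (\<phi> - 1)"
    by (simp add: power3_eq_cube sq)
  also have "\<dots> = 2 * \<phi> - 3"
    using golden_mean_square by (simp add: algebra_simps)
  finally show "1 / \<phi> ^ 3 = 2 * \<phi> - 3" by (simp add: inv_pow)
  have "(\<phi> - 1) ^ 4 = (2 - \<phi>) * (2 - \<phi>)"
    by (simp add: power4_eq_xxxx sq mult.assoc)
  also have "\<dots> = 5 - 3 * \<phi>"
    using golden_mean_square by (simp add: algebra_simps)
  finally show "1 / \<phi> ^ 4 = 5 - 3 * \<phi>" by (simp add: inv_pow)
qed

text \<open>
  Irrationality of \<open>\<phi>\<close> by descent: if \<open>c \<phi> = b\<close>, then \<open>(b - c) \<phi> = c (\<phi>\<^sup>2 - \<phi>) = c\<close>, with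
  the smaller positive denominator \<open>b - c = c (\<phi> - 1)\<close>.
\<close>

lemma golden_mean_irrational:
  fixes b c :: nat
  assumes "real c * \<phi> = real b"
  shows "c = 0"
  using assms
proof (induction c arbitrary: b rule: less_induct)
  case (less c)
  show ?case
  proof (rule ccontr)
    assume c: "c \<noteq> 0"
    have "real c * 1 < real c * \<phi>" "real c * \<phi> < real c * 2"
      using c golden_mean_bounds by auto
    then have bc: "c < b" "b < 2 * c"
      using less.prems by simp_all
    have "real (b - c) * \<phi> = real c * (\<phi> * \<phi> - \<phi>)"
      using bc less.prems by (simp add: of_nat_diff algebra_simps)
    also have "\<dots> = real c"
      by (simp add: golden_mean_square)
    finally have "b - c = 0"
      using bc by (intro less.IH[of "b - c" c]) auto
    then show False using bc by simp
  qed
qed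

section \<open>The spectrum as a cut-and-project set\<close>

text \<open>Digits are added and removed at the low end, that is, by Horner steps.\<close>

lemma zero_in_spectrum: "0 \<in> \<Lambda> q"
  unfolding spectrum_def by (auto intro!: exI[of _ "\<lambda>_. 0"])

lemma spectrum_Horner:
  assumes "x \<in> \<Lambda> q" "d \<in> {0, 1}"
  shows "d + q * x \<in> \<Lambda> q"
proof -
  obtain e n where x: "x = (\<Sum>i\<le>n. e i * q ^ i)" and e: "\<forall>i\<le>n. e i \<in> {0, 1 :: real}"
    using assms(1) unfolding spectrum_def by blast
  have "d + q * x = (\<Sum>i\<le>Suc n. case_nat d e i * q ^ i)"
    unfolding sum.atMost_Suc_shift by (simp add: x sum_distrib_left mult.left_commute)
  moreover have "\<forall>i\<le>Suc n. case_nat d e i \<in> {0, 1}"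
    using e assms(2) by (auto split: nat.split)
  ultimately show ?thesis unfolding spectrum_def by blast
qed

text \<open>
  A Horner step \<open>x \<mapsto> d + \<phi> x\<close> acts on the conjugate by \<open>y \<mapsto> d - y / \<phi>\<close>. This maps the
  window \<open>(-1, \<phi>)\<close> onto \<open>(d - 1, d + 1/\<phi>)\<close>, which is again inside the window for both digits.
\<close>

lemma spectrum_imp_window:
  assumes "x \<in> \<Lambda> \<phi>"
  shows "\<exists>(a :: nat) (b :: nat). x = a + b * \<phi> \<and> -1 < a - b * (\<phi> - 1) \<and> a - b * (\<phi> - 1) < \<phi>"
proof -
  have "\<exists>(a :: nat) (b :: nat). (\<Sum>i\<le>n. e i * \<phi> ^ i) = a + b * \<phi>
          \<and> -1 < a - b * (\<phi> - 1) \<and> a - b * (\<phi> - 1) < \<phi>"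
    if "\<forall>i\<le>n. e i \<in> {0, 1}" for e :: "nat \<Rightarrow> real" and n
    using that
  proof (induction n arbitrary: e)
    case 0
    then have "e 0 = 0 \<or> e 0 = 1" by simp
    then show ?case
    proof
      assume "e 0 = 0"
      then show ?thesis
        using golden_mean_bounds by (intro exI[of _ 0]) simp
    next
      assume "e 0 = 1"
      then show ?thesis
        using golden_mean_bounds by (intro exI[of _ 1] exI[of _ 0]) simp
    qed
  next
    case (Suc n)
    obtain a b :: nat where x: "(\<Sum>i\<le>n. e (Suc i) * \<phi> ^ i) = a + b * \<phi>"
      and y: "-1 < a - b * (\<phi> - 1)" "a - b * (\<phi> - 1) < \<phi>"
      using Suc.IH[of "\<lambda>i. e (Suc i)"] Suc.prems by auto
    obtain d :: nat where d: "e 0 = real d" "d = 0 \<or> d = 1"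
      using Suc.prems by (metis insertE le0 of_nat_0 of_nat_1 singletonD)
    have "(\<Sum>i\<le>Suc n. e i * \<phi> ^ i) = e 0 + \<phi> * (\<Sum>i\<le>n. e (Suc i) * \<phi> ^ i)"
      unfolding sum.atMost_Suc_shift by (simp add: sum_distrib_left mult.left_commute)
    also have "\<dots> = d + a * \<phi> + b * (\<phi> * \<phi>)"
      unfolding x d(1) by (simp add: algebra_simps)
    also have "\<dots> = real (d + b) + real (a + b) * \<phi>"
      by (simp add: golden_mean_square algebra_simps)
    finally have x': "(\<Sum>i\<le>Suc n. e i * \<phi> ^ i) = real (d + b) + real (a + b) * \<phi>" .
    have conj: "real (d + b) - real (a + b) * (\<phi> - 1) = d - (\<phi> - 1) * (a - b * (\<phi> - 1))"
    proof -
      have "(\<phi> - 1) * (a - b * (\<phi> - 1)) = a * (\<phi> - 1) - b * (\<phi> * \<phi> - 2 * \<phi> + 1)"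
        by (simp add: algebra_simps)
      then show ?thesis by (simp add: golden_mean_square algebra_simps)
    qed
    have "(\<phi> - 1) * (a - b * (\<phi> - 1)) < (\<phi> - 1) * \<phi>"
      "(\<phi> - 1) * (-1) < (\<phi> - 1) * (a - b * (\<phi> - 1))"
      using y golden_mean_bounds by (intro mult_strict_left_mono; simp)+
    then have "(\<phi> - 1) * (a - b * (\<phi> - 1)) < 1"
      "1 - \<phi> < (\<phi> - 1) * (a - b * (\<phi> - 1))"
      by (simp_all add: golden_mean_square left_diff_distrib)
    then have "-1 < real (d + b) - real (a + b) * (\<phi> - 1)"
      "real (d + b) - real (a + b) * (\<phi> - 1) < \<phi>"
      unfolding conj using d(2) golden_mean_bounds by auto
    with x' show ?case by blast
  qed
  then show ?thesis
    using assms unfolding spectrum_def by blast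
qed

text \<open>
  Undoing a Horner step sends the conjugate \<open>y\<close> to \<open>\<phi> (d - y)\<close>. This stays in the window if the
  lowest digit \<open>d\<close> is \<open>0\<close> for \<open>y < 1/\<phi>\<close> and \<open>1\<close> otherwise. The index \<open>a + 2b\<close> changes to
  \<open>a + b - d\<close>, which is smaller unless \<open>b = d = 0\<close>; in that case \<open>0 \<le> a < 1/\<phi>\<close>, so the
  process has arrived at \<open>0\<close>.
\<close>

lemma window_imp_spectrum:
  fixes a b :: int
  assumes "b \<ge> 0" "-1 < a - b * (\<phi> - 1)" "a - b * (\<phi> - 1) < \<phi>"
  shows "a + b * \<phi> \<in> \<Lambda> \<phi>"
  using assms
proof (induction "nat (a + 2 * b)" arbitrary: a b rule: less_induct)
  case less
  define d :: int where "d = (if a - b * (\<phi> - 1) < \<phi> - 1 then 0 else 1)"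
  have d01: "real_of_int d \<in> {0, 1}" by (simp add: d_def)
  have b: "0 \<le> b * (\<phi> - 1)"
    using less.prems(1) golden_mean_bounds by simp
  have "-1 < real_of_int a" using b less.prems(2) by linarith
  then have a: "0 \<le> a" by linarith
  show ?case
  proof (cases "a + b - d < a + 2 * b")
    case False
    then have "b = 0" "d = 0"
      using less.prems(1) by (auto simp: d_def split: if_splits)
    moreover from this have "real_of_int a < 1"
      using golden_mean_bounds by (auto simp: d_def split: if_splits)
    ultimately have "a = 0" "b = 0" using a by linarith+
    then show ?thesis by (simp add: zero_in_spectrum)
  next
    case True
    define a' b' where "a' = b - a + d" and "b' = a - d"
    have "d \<le> a"
    proof (cases "d = 0")
      case False
      then have "d = 1" "real_of_int a \<ge> \<phi> - 1"
        using b by (auto simp: d_def split: if_splits)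
      then show ?thesis using golden_mean_bounds by linarith
    qed (use a in simp)
    then have b': "b' \<ge> 0" by (simp add: b'_def)
    have conj: "a' - b' * (\<phi> - 1) = \<phi> * (d - (a - b * (\<phi> - 1)))"
    proof -
      have "\<phi> * (d - (a - b * (\<phi> - 1))) = \<phi> * (d - a) + b * (\<phi> * \<phi> - \<phi>)"
        by (simp add: algebra_simps)
      then show ?thesis by (simp add: a'_def b'_def golden_mean_square algebra_simps)
    qed
    have "d - (a - b * (\<phi> - 1)) < 1" "- (\<phi> - 1) < d - (a - b * (\<phi> - 1))"
      using less.prems golden_mean_bounds by (auto simp: d_def)
    then have "\<phi> * (d - (a - b * (\<phi> - 1))) < \<phi> * 1"
      "\<phi> * (- (\<phi> - 1)) < \<phi> * (d - (a - b * (\<phi> - 1)))"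
      using golden_mean_bounds by (intro mult_strict_left_mono; simp)+
    then have y': "-1 < a' - b' * (\<phi> - 1)" "a' - b' * (\<phi> - 1) < \<phi>"
      unfolding conj by (simp_all add: golden_mean_square right_diff_distrib)
    have "nat (a' + 2 * b') < nat (a + 2 * b)"
      using True less.prems(1) a \<open>d \<le> a\<close>
      by (auto simp: a'_def b'_def d_def split: if_splits)
    then have "a' + b' * \<phi> \<in> \<Lambda> \<phi>"
      using b' y' by (rule less.hyps)
    then have "d + \<phi> * (a' + b' * \<phi>) \<in> \<Lambda> \<phi>"
      using d01 by (rule spectrum_Horner)
    moreover have "d + \<phi> * (a' + b' * \<phi>) = a + b * \<phi>"
    proof -
      have "d + \<phi> * (a' + b' * \<phi>) = d + a' * \<phi> + b' * (\<phi> * \<phi>)"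
        by (simp add: algebra_simps)
      then show ?thesis by (simp add: a'_def b'_def golden_mean_square algebra_simps)
    qed
    ultimately show ?thesis by simp
  qed
qed

section \<open>The increasing listing in closed form\<close>

text \<open>
  The coefficient \<open>b\<close> of \<open>\<phi>\<close> in \<open>\<lambda>\<^sub>n = (n - 2b) + b \<phi>\<close>; here \<open>2 - \<phi> = 1/\<phi>\<^sup>2\<close>.
\<close>

definition window_coord :: "nat \<Rightarrow> int" where
  "window_coord n = \<lfloor>(2 - \<phi>) * (real n + 1)\<rfloor>"

definition golden_listing :: "nat \<Rightarrow> real" where
  "golden_listing n = real n - (2 - \<phi>) * window_coord n"

text \<open>
  For \<open>a = n - 2b\<close> the conjugate is \<open>n - (\<phi> + 1) b\<close>, and \<open>(\<phi> + 1) (2 - \<phi>) = 1\<close>: the lower window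
  bound is the upper bound on the floor, and vice versa. The floor would also admit the left
  end \<open>-1\<close> of the window; irrationality excludes it.
\<close>

lemma window_iff:
  "window_coord n = b \<longleftrightarrow> -1 < n - b * (\<phi> + 1) \<and> n - b * (\<phi> + 1) < \<phi>"
proof -
  have inv: "(2 - \<phi>) * (\<phi> + 1) = 1"
    using golden_mean_square by (simp add: algebra_simps)
  have scale: "(2 - \<phi>) * r \<le> s \<longleftrightarrow> r \<le> s * (\<phi> + 1)" for r s
  proof -
    have "(2 - \<phi>) * r \<le> s \<longleftrightarrow> (2 - \<phi>) * r \<le> (2 - \<phi>) * (s * (\<phi> + 1))"
      by (metis inv mult.commute mult.left_commute mult.right_neutral)
    also have "\<dots> \<longleftrightarrow> r \<le> s * (\<phi> + 1)"
      using golden_mean_bounds by (intro mult_le_cancel_left_pos) simp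
    finally show ?thesis .
  qed
  have scale': "s \<le> (2 - \<phi>) * r \<longleftrightarrow> s * (\<phi> + 1) \<le> r" for r s
  proof -
    have "s \<le> (2 - \<phi>) * r \<longleftrightarrow> (2 - \<phi>) * (s * (\<phi> + 1)) \<le> (2 - \<phi>) * r"
      by (metis inv mult.commute mult.left_commute mult.right_neutral)
    also have "\<dots> \<longleftrightarrow> s * (\<phi> + 1) \<le> r"
      using golden_mean_bounds by (intro mult_le_cancel_left_pos) simp
    finally show ?thesis .
  qed
  have ne: "b * (\<phi> + 1) \<noteq> real n + 1"
  proof
    assume eq: "b * (\<phi> + 1) = real n + 1"
    then have "0 < b * (\<phi> + 1)" by linarith
    then have "0 < b"
      using golden_mean_bounds by (simp add: zero_less_mult_iff)
    moreover have "real_of_int b \<le> b * (\<phi> + 1)"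
      using \<open>0 < b\<close> golden_mean_bounds by simp
    then have "b \<le> int n + 1" using eq by linarith
    ultimately have "real (nat b) * \<phi> = real (nat (int n + 1 - b))"
      using eq by (simp add: algebra_simps)
    then have "nat b = 0" by (rule golden_mean_irrational)
    then show False using \<open>0 < b\<close> by simp
  qed
  have "window_coord n = b \<longleftrightarrow> b \<le> (2 - \<phi>) * (real n + 1) \<and> \<not> b + 1 \<le> (2 - \<phi>) * (real n + 1)"
    unfolding window_coord_def floor_eq_iff by auto
  also have "\<dots> \<longleftrightarrow> b * (\<phi> + 1) \<le> real n + 1 \<and> real n + 1 < (real_of_int b + 1) * (\<phi> + 1)"
    unfolding scale' by auto
  also have "\<dots> \<longleftrightarrow> -1 < n - b * (\<phi> + 1) \<and> n - b * (\<phi> + 1) < \<phi>"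
    using ne by (auto simp: algebra_simps)
  finally show ?thesis .
qed

lemma range_golden_listing: "range golden_listing = \<Lambda> \<phi>"
proof (intro subset_antisym subsetI)
  fix x assume "x \<in> range golden_listing"
  then obtain n where n: "x = golden_listing n" by blast
  define b where "b = window_coord n"
  have "b \<ge> 0"
    using golden_mean_bounds by (simp add: b_def window_coord_def)
  moreover have "-1 < n - b * (\<phi> + 1)" "n - b * (\<phi> + 1) < \<phi>"
    using window_iff[of n b] by (simp_all add: b_def)
  ultimately have "real_of_int (int n - 2 * b) + b * \<phi> \<in> \<Lambda> \<phi>"
    by (intro window_imp_spectrum) (simp_all add: algebra_simps)
  then show "x \<in> \<Lambda> \<phi>"
    by (simp add: n golden_listing_def b_def algebra_simps)
next
  fix x assume "x \<in> \<Lambda> \<phi>"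
  then obtain a b :: nat where x: "x = a + b * \<phi>"
    and y: "-1 < a - b * (\<phi> - 1)" "a - b * (\<phi> - 1) < \<phi>"
    using spectrum_imp_window by blast
  have "window_coord (a + 2 * b) = int b"
    using y unfolding window_iff by (simp add: algebra_simps)
  then have "x = golden_listing (a + 2 * b)"
    by (simp add: x golden_listing_def algebra_simps)
  then show "x \<in> range golden_listing" by blast
qed

lemma window_coord_increment:
  "window_coord (N + k) - window_coord k < (2 - \<phi>) * N + 1"
proof -
  have "window_coord (N + k) \<le> (2 - \<phi>) * (real (N + k) + 1)"
    "(2 - \<phi>) * (real k + 1) < window_coord k + 1"
    unfolding window_coord_def by linarith+
  then show ?thesis by (simp add: algebra_simps)
qed

lemma strict_mono_golden_listing: "strict_mono golden_listing"
  unfolding strict_mono_Suc_iff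
proof
  fix n
  have "window_coord (Suc n) - window_coord n < (2 - \<phi>) + 1"
    using window_coord_increment[of 1 n] by simp
  then have "window_coord (Suc n) - window_coord n \<le> 1"
    using golden_mean_bounds by linarith
  then have "(2 - \<phi>) * (window_coord (Suc n) - window_coord n) \<le> (2 - \<phi>) * 1"
    using golden_mean_bounds by (intro mult_left_mono) linarith+
  then show "golden_listing n < golden_listing (Suc n)"
    using golden_mean_bounds by (simp add: golden_listing_def algebra_simps)
qed

text \<open>
  If the range of \<open>g\<close> lies in that of \<open>f\<close>, then \<open>g = f \<circ> h\<close> for a strictly increasing \<open>h\<close> on
  the naturals, and such an \<open>h\<close> satisfies \<open>n \<le> h n\<close>.
\<close>

lemma strict_mono_range_le:
  fixes f g :: "nat \<Rightarrow> 'a :: linorder"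
  assumes f: "strict_mono f" and g: "strict_mono g" and sub: "range g \<subseteq> range f"
  shows "f n \<le> g n"
proof -
  have "\<forall>n. \<exists>m. g n = f m" using sub by blast
  then obtain h where h: "\<And>n. g n = f (h n)" by metis
  have "strict_mono h"
    using f g h by (metis strict_monoD strict_monoI strict_mono_less)
  then have "n \<le> h n" by (rule strict_mono_imp_increasing)
  then show ?thesis
    using f h by (simp add: strict_mono_less_eq)
qed

lemma spectrum_nth_eq: "spectrum_nth \<phi> = golden_listing"
  unfolding spectrum_nth_def
proof (rule the_equality)
  show "strict_mono golden_listing \<and> range golden_listing = \<Lambda> \<phi>"
    using strict_mono_golden_listing range_golden_listing by blast
next
  fix l :: "nat \<Rightarrow> real" assume "strict_mono l \<and> range l = \<Lambda> \<phi>"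
  then show "l = golden_listing"
    using strict_mono_golden_listing range_golden_listing
    by (intro ext antisym strict_mono_range_le) auto
qed

section \<open>Lower bounds on gaps\<close>

theorem corollary3p1:
  shows "(\<forall>N::nat. N \<ge> 1 \<longrightarrow>
            (\<forall>k::nat. k \<ge> 1 \<longrightarrow>
               spectrum_nth \<phi> (N + k) - spectrum_nth \<phi> k \<ge> real N * gamma2 N))
       \<and> (\<forall>k::nat. k \<ge> 1 \<longrightarrow>
               spectrum_nth \<phi> (2 + k) - spectrum_nth \<phi> k \<ge> 2 * (\<phi> / 2))"
proof (intro conjI allI impI)
  have diff: "spectrum_nth \<phi> (N + k) - spectrum_nth \<phi> k
      = real N - (2 - \<phi>) * (window_coord (N + k) - window_coord k)" for N k
    by (simp add: spectrum_nth_eq golden_listing_def algebra_simps)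
  {
    fix N k :: nat
    assume N: "N \<ge> 1"
    have "(2 - \<phi>) * (window_coord (N + k) - window_coord k) \<le> (2 - \<phi>) * ((2 - \<phi>) * N + 1)"
      using window_coord_increment[of N k] golden_mean_bounds by (intro mult_left_mono) auto
    also have "\<dots> = (4 - 4 * \<phi> + \<phi> * \<phi>) * N + (2 - \<phi>)"
      by (simp add: algebra_simps)
    also have "\<dots> = (5 - 3 * \<phi>) * N + (2 - \<phi>)"
      by (simp add: golden_mean_square)
    finally have "real N - (5 - 3 * \<phi>) * N - (2 - \<phi>)
        \<le> spectrum_nth \<phi> (N + k) - spectrum_nth \<phi> k"
      unfolding diff by linarith
    moreover have "real N * gamma2 N = real N - (5 - 3 * \<phi>) * N - (5 - 2 * \<phi>)"
      using N unfolding gamma2_def golden_mean_inverse golden_mean_inverse_powers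
      by (simp add: field_simps)
    ultimately show "spectrum_nth \<phi> (N + k) - spectrum_nth \<phi> k \<ge> real N * gamma2 N"
      using golden_mean_bounds by linarith
  }
  {
    fix k :: nat
    have "window_coord (2 + k) - window_coord k < (2 - \<phi>) * 2 + 1"
      using window_coord_increment[of 2 k] by simp
    also have "\<dots> < 2"
      using golden_mean_bounds by simp
    finally have "window_coord (2 + k) - window_coord k \<le> 1"
      by linarith
    then have "(2 - \<phi>) * (window_coord (2 + k) - window_coord k) \<le> (2 - \<phi>) * 1"
      using golden_mean_bounds by (intro mult_left_mono) linarith+
    then show "spectrum_nth \<phi> (2 + k) - spectrum_nth \<phi> k \<ge> 2 * (\<phi> / 2)"
      unfolding diff by simp
  }
qed

end
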